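(* Let $\Sigma$ be a finite nonempty alphabet, $L\subseteq\Sigma^*$ and $\kappa(L)=n\ge 1$. If $L$ is a left ideal or a suffix-closed language, then $\sigma(L)\le n^{n-1}+n-1$. This bound is tight: for $n=1$ whenever $|\Sigma|\ge 1$, for $n=2$ whenever $|\Sigma|\ge 3$, for $n=3$ whenever $|\Sigma|\ge 4$, and for $n\ge 4$ whenever $|\Sigma|\ge 5$, there is a language over $\Sigma$ of the respective type with $\kappa(L)=n$ and $\sigma(L)=n^{n-1}+n-1$. Moreover, these alphabet sizes cannot be reduced.
   Context: For $L\subseteq\Sigma^*$ and $w\in\Sigma^*$, $w^{-1}L=\{x: wx\in L\}$; $\kappa(L)$ is the number of distinct such quotients (the number of states of a minimal DFA of $L$). The syntactic congruence: $x\approx_L y$ iff for all $u,v\in\Sigma^*$, $uxv\in L\Leftrightarrow uyv\in L$; $\sigma(L)$ is the cardinality of the syntactic semigroup $\Sigma^+/\approx_L$ (equivalently, of the transition semigroup of a minimal DFA of $L$, i.e. the set of state transformations induced by nonempty words). $L$ is a left ideal if it is nonempty and $L=\Sigma^*L$; $L$ is suffix-closed if $w\in L$ implies every suffix of $w$ is in $L$. *)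

theory Defs
  imports Main
begin

definition quotient_lang :: "'a list \<Rightarrow> 'a list set \<Rightarrow> 'a list set" where
  "quotient_lang w L = {x. w @ x \<in> L}"

definition kappa :: "'a set \<Rightarrow> 'a list set \<Rightarrow> nat" where
  "kappa \<Sigma> L = card {quotient_lang w L | w. w \<in> lists \<Sigma>}"

definition synt_cong :: "'a set \<Rightarrow> 'a list set \<Rightarrow> 'a list \<Rightarrow> 'a list \<Rightarrow> bool" where
  "synt_cong \<Sigma> L x y \<longleftrightarrow>
     (\<forall>u \<in> lists \<Sigma>. \<forall>v \<in> lists \<Sigma>. u @ x @ v \<in> L \<longleftrightarrow> u @ y @ v \<in> L)"

definition sigma :: "'a set \<Rightarrow> 'a list set \<Rightarrow> nat" where
  "sigma \<Sigma> L = card ((lists \<Sigma> - {[]}) //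
      {(x, y). x \<in> lists \<Sigma> - {[]} \<and> y \<in> lists \<Sigma> - {[]} \<and> synt_cong \<Sigma> L x y})"

definition left_ideal :: "'a set \<Rightarrow> 'a list set \<Rightarrow> bool" where
  "left_ideal \<Sigma> L \<longleftrightarrow> L \<noteq> {} \<and> L = {u @ v | u v. u \<in> lists \<Sigma> \<and> v \<in> L}"

definition suffix_closed :: "'a list set \<Rightarrow> bool" where
  "suffix_closed L \<longleftrightarrow> (\<forall>w \<in> L. \<forall>u v. w = u @ v \<longrightarrow> v \<in> L)"

definition min_alph :: "nat \<Rightarrow> nat" where
  "min_alph n = (if n \<le> 1 then 1 else if n = 2 then 3 else if n = 3 then 4 else 5)"

end

theory Submission
  imports Defs "HOL-Library.FuncSet" "HOL-Combinatorics.Permutations"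
begin

text \<open>
  Order the quotients of a left ideal \<open>L\<close> by inclusion. Then \<open>L\<close> is the least quotient and words act by
  monotone maps, so it suffices to bound the number of monotone self-maps of a poset with \<open>n\<close>
  elements and a least element \<open>m\<close>. If the elements above \<open>m\<close> form an antichain, such a map
  either fixes \<open>m\<close> or is constant, and there are \<open>n ^ (n - 1) + n - 1\<close> maps of these two kinds. Otherwise
  the count is strictly smaller. Hence the bound is attained exactly when the transition semigroup
  consists of all maps that fix \<open>m\<close> or are constant.

  Generating this semigroup requires a constant letter, a letter sending some \<open>x \<noteq> m\<close> to \<open>m\<close>, a
  non-injective letter under which only \<open>m\<close> goes to \<open>m\<close> (if \<open>n \<ge> 3\<close>), and letters
  generating the symmetric group on \<open>n - 1\<close> points, which is not cyclic for \<open>n \<ge> 4\<close>. Conversely, a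
  cycle, a transposition and one letter of each other kind suffice. Suffix-closed languages are
  the complements of left ideals, together with the full language.
\<close>

section \<open>Monotone maps of a poset with least element\<close>

text \<open>A minimal element lies in the up-set of no other element, so deleting it leaves the
  other up-sets unchanged, while its own has at most \<open>card A\<close> elements. Chains are the
  extreme case.\<close>

lemma sum_card_upset_le:
  fixes A :: "'b::order set" and F :: "nat \<Rightarrow> nat"
  assumes "finite A" and "mono F"
  shows "(\<Sum>p\<in>A. F (card {q \<in> A. p \<le> q})) \<le> (\<Sum>j=1..card A. F j)"
  using assms(1)
proof (induction A rule: finite_psubset_induct)
  case (psubset A)
  show ?case
  proof (cases "A = {}")
    case False
    with psubset.hyps obtain p where p: "p \<in> A" and pmin: "\<forall>b\<in>A. b \<le> p \<longrightarrow> p = b"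
      using finite_has_minimal by blast
    have "(\<Sum>q\<in>A. F (card {r \<in> A. q \<le> r}))
        = F (card {r \<in> A. p \<le> r}) + (\<Sum>q\<in>A - {p}. F (card {r \<in> A. q \<le> r}))"
      using psubset.hyps p by (rule sum.remove)
    also have "(\<Sum>q\<in>A - {p}. F (card {r \<in> A. q \<le> r}))
        = (\<Sum>q\<in>A - {p}. F (card {r \<in> A - {p}. q \<le> r}))"
    proof (rule sum.cong)
      fix q assume "q \<in> A - {p}"
      hence "{r \<in> A. q \<le> r} = {r \<in> A - {p}. q \<le> r}" using pmin by blast
      thus "F (card {r \<in> A. q \<le> r}) = F (card {r \<in> A - {p}. q \<le> r})" by simp
    qed simp
    also have "\<dots> \<le> (\<Sum>j=1..card (A - {p}). F j)"
      using psubset.IH[of "A - {p}"] p by blast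
    also have "F (card {r \<in> A. p \<le> r}) \<le> F (card A)"
      by (rule monoD[OF assms(2)]) (use psubset.hyps in \<open>auto intro: card_mono\<close>)
    also have "F (card A) + (\<Sum>j=1..card (A - {p}). F j) = (\<Sum>j=1..card A. F j)"
      using card.remove[OF psubset.hyps p] by simp
    finally show ?thesis by simp
  qed simp
qed

text \<open>Fixing the smaller component turns the count into a sum of up-set sizes, bounded by a
  Gauss sum.\<close>

lemma card_comparable_pairs_le:
  fixes U :: "'b::order set"
  assumes "finite U"
  shows "2 * card {(x, y). x \<in> U \<and> y \<in> U \<and> x \<le> y} \<le> card U * (card U + 1)"
proof -
  have "{(x, y). x \<in> U \<and> y \<in> U \<and> x \<le> y} = (SIGMA x:U. {y \<in> U. x \<le> y})" by auto
  hence "card {(x, y). x \<in> U \<and> y \<in> U \<and> x \<le> y} = (\<Sum>x\<in>U. card {y \<in> U. x \<le> y})"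
    using assms by (simp add: card_SigmaI)
  also have "\<dots> \<le> (\<Sum>j=1..card U. j)"
    using sum_card_upset_le[OF assms, of "\<lambda>j. j"] by (simp add: mono_def)
  also have "2 * \<dots> = card U * (card U + 1)"
    using double_gauss_sum_from_Suc_0[of "card U", where 'a=nat] by simp
  finally show ?thesis by simp
qed

section \<open>Elementary inequalities between powers\<close>

text \<open>This is Bernoulli's inequality \<open>(1 + 1/x)^m >= 1 + m/x\<close>, cleared of
  denominators and combined with \<open>x + m >= 2 * x\<close>.\<close>

lemma Suc_power_ge_double:
  fixes x m :: nat
  assumes "x \<le> m" and "m > 0"
  shows "2 * x ^ m \<le> (x + 1) ^ m"
proof -
  have *: "x * (x + 1) ^ m \<ge> (x + m) * x ^ m" for m
  proof (induction m)
    case (Suc m)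
    have "(x + Suc m) * x ^ Suc m \<le> (x + 1) * ((x + m) * x ^ m)"
      by (simp add: algebra_simps)
    also have "\<dots> \<le> (x + 1) * (x * (x + 1) ^ m)" by (rule mult_left_mono[OF Suc]) simp
    finally show ?case by (simp add: algebra_simps)
  qed simp
  show ?thesis
  proof (cases "x = 0")
    case True thus ?thesis using assms by (simp add: power_0_left)
  next
    case False
    have "x * (2 * x ^ m) = (x + x) * x ^ m" by simp
    also have "\<dots> \<le> (x + m) * x ^ m" using assms by (intro mult_right_mono) auto
    also have "\<dots> \<le> x * (x + 1) ^ m" by (rule *)
    finally show ?thesis using False by simp
  qed
qed

text \<open>The binomial expansion of \<open>(1 + 1/x)^m\<close> is cut off after the quadratic term
  and multiplied by \<open>2 * x^(m+2)\<close>. Integers keep the difference \<open>m - 1\<close>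
  genuine at \<open>m = 0\<close>.\<close>

lemma Suc_power_ge_second_order:
  fixes x :: int
  assumes "x \<ge> 0"
  shows "x ^ m * (2 * x\<^sup>2 + 2 * int m * x + int m * (int m - 1)) \<le> 2 * x\<^sup>2 * (x + 1) ^ m"
proof (induction m)
  case (Suc m)
  have "x * (2 * x\<^sup>2 + 2 * int (Suc m) * x + int (Suc m) * (int (Suc m) - 1))
      = (x + 1) * (2 * x\<^sup>2 + 2 * int m * x + int m * (int m - 1)) - int m * (int m - 1)"
    by (simp add: algebra_simps power2_eq_square)
  moreover have "int m * (int m - 1) \<ge> 0" by (cases m) auto
  ultimately have "x * (2 * x\<^sup>2 + 2 * int (Suc m) * x + int (Suc m) * (int (Suc m) - 1))
      \<le> (x + 1) * (2 * x\<^sup>2 + 2 * int m * x + int m * (int m - 1))" by linarith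
  hence "x ^ m * (x * (2 * x\<^sup>2 + 2 * int (Suc m) * x + int (Suc m) * (int (Suc m) - 1)))
      \<le> x ^ m * ((x + 1) * (2 * x\<^sup>2 + 2 * int m * x + int m * (int m - 1)))"
    by (rule mult_left_mono) (use assms in simp)
  also have "\<dots> = (x + 1) * (x ^ m * (2 * x\<^sup>2 + 2 * int m * x + int m * (int m - 1)))"
    by (simp only: ac_simps)
  also have "\<dots> \<le> (x + 1) * (2 * x\<^sup>2 * (x + 1) ^ m)"
    by (rule mult_left_mono[OF Suc]) (use assms in simp)
  finally show ?case by (simp only: power_Suc ac_simps)
qed simp

text \<open>The base \<open>m + 2\<close> exceeds the exponent, so Bernoulli's inequality falls just
  short. With \<open>x = m + 2\<close> the quadratic term suffices once
  \<open>4 * x \<le> m * (m - 1)\<close>, which holds from \<open>m = 7\<close> on.\<close>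

lemma shifted_power_ge_double:
  assumes "m \<ge> 7"
  shows "2 * (m + 2) ^ m \<le> (m + 3) ^ (m::nat)"
proof -
  let ?x = "int m + 2"
  have "int m * (int m - 1) \<ge> 4 * ?x"
  proof -
    have "4 * ?x \<le> int m * 6" using assms by simp
    also have "\<dots> \<le> int m * (int m - 1)" using assms by (intro mult_left_mono) auto
    finally show ?thesis .
  qed
  hence "4 * ?x\<^sup>2 \<le> 2 * ?x\<^sup>2 + 2 * int m * ?x + int m * (int m - 1)"
    by (simp add: power2_eq_square algebra_simps)
  hence "?x ^ m * (4 * ?x\<^sup>2) \<le> ?x ^ m * (2 * ?x\<^sup>2 + 2 * int m * ?x + int m * (int m - 1))"
    by (rule mult_left_mono) simp
  also have "\<dots> \<le> 2 * ?x\<^sup>2 * (?x + 1) ^ m" by (rule Suc_power_ge_second_order) simp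
  finally have "(2 * ?x\<^sup>2) * (2 * ?x ^ m) \<le> (2 * ?x\<^sup>2) * (?x + 1) ^ m" by (simp add: ac_simps)
  hence "2 * ?x ^ m \<le> (?x + 1) ^ m" by (rule mult_left_le_imp_le) simp
  hence "int (2 * (m + 2) ^ m) \<le> int ((m + 3) ^ m)" by (simp add: ac_simps)
  thus ?thesis by linarith
qed

text \<open>Twice the estimate for the number of monotone maps when \<open>n = m + 3\<close>. The summands decay at
  least geometrically from \<open>j = m + 2\<close> downwards; this is sharp enough for \<open>m \<ge> 7\<close>.\<close>

lemma sum_power_less:
  "(\<Sum>j=1..m+3. (j + 1) * j ^ (m + 1)) < 2 * ((m + 3) ^ (m + 2) + m + (2::nat))"
proof (cases "m \<ge> 7")
  case True
  \<comment> \<open>Twice the term at \<open>k\<close> is at most the term at \<open>k + 1\<close>,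
    so every partial sum is at most twice its last term.\<close>
  have geo: "(\<Sum>j=1..k. (j + 1) * j ^ (m + 1)) \<le> 2 * ((k + 1) * k ^ (m + 1))" if "k \<le> m + 2" for k
    using that
  proof (induction k)
    case (Suc k)
    have "2 * ((k + 1) * k ^ (m + 1)) \<le> (k + 1) * (k + 1) ^ (m + 1)"
      using mult_left_mono[OF Suc_power_ge_double[of k "m + 1"], of "k + 1"] Suc.prems by simp
    also have "\<dots> \<le> (k + 2) * (k + 1) ^ (m + 1)" by (rule mult_right_mono) auto
    finally show ?case using Suc by simp
  qed simp
  have "(\<Sum>j=1..m+3. (j + 1) * j ^ (m + 1))
      = (\<Sum>j=1..m+2. (j + 1) * j ^ (m + 1)) + (m + 4) * (m + 3) ^ (m + 1)"
    using sum.cl_ivl_Suc[of "\<lambda>j. (j + 1) * j ^ (m + 1)" 1 "m + 2"] by (simp add: numeral_eq_Suc)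
  also have "\<dots> \<le> 2 * ((m + 3) * (m + 2) ^ (m + 1)) + (m + 4) * (m + 3) ^ (m + 1)"
    using geo[of "m + 2"] by (simp add: numeral_eq_Suc)
  also have "2 * ((m + 3) * (m + 2) ^ (m + 1)) = (m + 3) * (m + 2) * (2 * (m + 2) ^ m)"
    by (simp only: power_add power_one_right ac_simps)
  also have "\<dots> \<le> (m + 3) * (m + 2) * (m + 3) ^ m"
    by (rule mult_left_mono[OF shifted_power_ge_double[OF True]]) simp
  \<comment> \<open>The coefficients \<open>m + 2\<close> and \<open>m + 4\<close> of
    \<open>(m + 3) ^ (m + 1)\<close> add up to \<open>2 * (m + 3)\<close>; strictness comes from the
    extra \<open>m + 2\<close> in the claim.\<close>
  also have "\<dots> + (m + 4) * (m + 3) ^ (m + 1) = 2 * (m + 3) ^ (m + 2)"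
    by (simp add: algebra_simps)
  finally show ?thesis by simp
next
  case False
  hence m: "m \<in> {0, 1, 2, 3, 4, 5, 6}" by auto
  have "{1..3} = {1, 2, 3::nat}" "{1..4} = {1, 2, 3, 4::nat}" "{1..5} = {1, 2, 3, 4, 5::nat}"
    "{1..6} = {1, 2, 3, 4, 5, 6::nat}" "{1..7} = {1, 2, 3, 4, 5, 6, 7::nat}"
    "{1..8} = {1, 2, 3, 4, 5, 6, 7, 8::nat}" "{1..9} = {1, 2, 3, 4, 5, 6, 7, 8, 9::nat}"
    by auto
  with m show ?thesis by (auto simp del: One_nat_def)
qed

section \<open>Counting monotone self-maps\<close>

definition mono_maps :: "'b::order set \<Rightarrow> ('b \<Rightarrow> 'b) set" where
  "mono_maps P = {f \<in> P \<rightarrow>\<^sub>E P. \<forall>x\<in>P. \<forall>y\<in>P. x \<le> y \<longrightarrow> f x \<le> f y}"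

text \<open>The constant map to \<open>m\<close> already fixes \<open>m\<close>; taking only the
  other constants keeps the union disjoint.\<close>

definition fixing_or_const :: "'b set \<Rightarrow> 'b \<Rightarrow> ('b \<Rightarrow> 'b) set" where
  "fixing_or_const P m = {f \<in> P \<rightarrow>\<^sub>E P. f m = m} \<union> (\<lambda>c. \<lambda>x\<in>P. c) ` (P - {m})"

lemma finite_mono_maps: "finite P \<Longrightarrow> finite (mono_maps P)"
  unfolding mono_maps_def by (rule finite_subset[of _ "P \<rightarrow>\<^sub>E P"]) (auto intro: finite_PiE)

lemma finite_fixing_or_const: "finite P \<Longrightarrow> finite (fixing_or_const P m)"
  unfolding fixing_or_const_def
  by (intro finite_UnI finite_imageI finite_Diff)
     (rule finite_subset[of _ "P \<rightarrow>\<^sub>E P"], auto intro: finite_PiE)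

lemma card_fixing_or_const:
  assumes "finite P" and "m \<in> P"
  shows "card (fixing_or_const P m) = card P ^ (card P - 1) + card P - 1"
proof -
  have "{f \<in> P \<rightarrow>\<^sub>E P. f m = m} = (\<Pi>\<^sub>E x\<in>P. if x = m then {m} else P)"
  proof (intro equalityI subsetI)
    fix f assume "f \<in> (\<Pi>\<^sub>E x\<in>P. if x = m then {m} else P)"
    hence f: "\<And>x. x \<in> P \<Longrightarrow> f x \<in> (if x = m then {m} else P)"
      and ext: "f \<in> extensional P" by (auto simp only: PiE_iff)
    have "f x \<in> P" if "x \<in> P" for x using f[OF that] assms(2) by (auto split: if_splits)
    thus "f \<in> {f \<in> P \<rightarrow>\<^sub>E P. f m = m}" using f[OF assms(2)] ext by (simp add: PiE_iff)
  qed (auto simp: PiE_iff)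
  hence "card {f \<in> P \<rightarrow>\<^sub>E P. f m = m} = (\<Prod>x\<in>P. card (if x = m then {m} else P))"
    using assms(1) by (simp add: card_PiE)
  also have "\<dots> = (\<Prod>x\<in>P - {m}. card (if x = m then {m} else P))"
    by (subst prod.remove[OF assms]) simp
  also have "\<dots> = card P ^ (card P - 1)" using assms by simp
  finally have 1: "card {f \<in> P \<rightarrow>\<^sub>E P. f m = m} = card P ^ (card P - 1)" .
  have "inj_on (\<lambda>c. \<lambda>x\<in>P. c) (P - {m})"
    by (rule inj_onI) (use assms(2) in \<open>metis restrict_apply'\<close>)
  hence 2: "card ((\<lambda>c. \<lambda>x\<in>P. c) ` (P - {m})) = card P - 1"
    using assms by (simp add: card_image)
  have "{f \<in> P \<rightarrow>\<^sub>E P. f m = m} \<inter> (\<lambda>c. \<lambda>x\<in>P. c) ` (P - {m}) = {}"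
    using assms by auto
  moreover have "finite {f \<in> P \<rightarrow>\<^sub>E P. f m = m}"
    by (rule finite_subset[of _ "P \<rightarrow>\<^sub>E P"]) (use assms in \<open>auto intro: finite_PiE\<close>)
  moreover have "card P > 0" using assms by (auto simp: card_gt_0_iff)
  ultimately show ?thesis
    unfolding fixing_or_const_def using assms 1 2 by (subst card_Un_disjoint) auto
qed

text \<open>If \<open>f m\<close> differs from \<open>m\<close>, all values of \<open>f\<close> lie
  above \<open>f m\<close> and so differ from \<open>m\<close> as well; among such elements nothing
  is strictly comparable, hence all values equal \<open>f m\<close>.\<close>

lemma mono_maps_subset_fixing_or_const:
  assumes m: "m \<in> P" "\<And>x. x \<in> P \<Longrightarrow> m \<le> x"
    and antichain: "\<And>a b. a \<in> P - {m} \<Longrightarrow> b \<in> P - {m} \<Longrightarrow> \<not> a < b"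
  shows "mono_maps P \<subseteq> fixing_or_const P m"
proof
  fix f assume f: "f \<in> mono_maps P"
  show "f \<in> fixing_or_const P m"
  proof (cases "f m = m")
    case True thus ?thesis using f by (auto simp: fixing_or_const_def mono_maps_def)
  next
    case False
    have fm: "f m \<in> P" using f m by (auto simp: mono_maps_def)
    have "f x = f m" if "x \<in> P" for x
    proof -
      have "f m \<le> f x" "f x \<in> P" using f m that by (auto simp: mono_maps_def)
      moreover have "f x \<noteq> m" using m(2)[OF fm] False \<open>f m \<le> f x\<close> by auto
      ultimately show ?thesis using antichain[of "f m" "f x"] fm False by (auto simp: less_le)
    qed
    hence "f = (\<lambda>x\<in>P. f m)"
      using f by (auto simp: mono_maps_def PiE_iff extensional_def)
    thus ?thesis using fm False unfolding fixing_or_const_def by blast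
  qed
qed

text \<open>A monotone map with \<open>f m = p\<close> takes values above \<open>p\<close>, and \<open>f a \<le> f b\<close> leaves about half of
  the pairs of values at \<open>a < b\<close>. Summing over \<open>p\<close> along a linear extension gives the bound.\<close>

lemma card_mono_maps_less:
  fixes P :: "'b::order set"
  assumes P: "finite P" and m: "m \<in> P" "\<And>x. x \<in> P \<Longrightarrow> m \<le> x"
    and ab: "a \<in> P - {m}" "b \<in> P - {m}" "a < b"
  shows "card (mono_maps P) < card P ^ (card P - 1) + card P - 1"
proof -
  define up where "up p = {q \<in> P. p \<le> q}" for p
  define R where "R = P - {m, a, b}"
  define cmp where "cmp p = {(x, y). x \<in> up p \<and> y \<in> up p \<and> x \<le> y}" for p
  define n where "n = card P"
  have "card {m, a, b} = 3" using ab by auto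
  moreover have sub: "{m, a, b} \<subseteq> P" using ab m by auto
  ultimately have n3: "n \<ge> 3" and cardR: "card R = n - 3"
    using card_mono[OF P sub] card_Diff_subset[of "{m,a,b}" P] by (auto simp: n_def R_def)
  have finup: "finite (up p)" for p using P by (simp add: up_def)
  have fincmp: "finite (cmp p)" for p
    by (rule finite_subset[of _ "up p \<times> up p"]) (auto simp: cmp_def finup)
  have fibre: "2 * card {f \<in> mono_maps P. f m = p} \<le> (card (up p) + 1) * card (up p) ^ (n - 2)" for p
  proof -
    \<comment> \<open>With \<open>f m = p\<close> fixed, \<open>f\<close> is determined by its
      values at \<open>a\<close> and \<open>b\<close>, a comparable pair above \<open>p\<close>, and
      by its values on \<open>R\<close>, each above \<open>p\<close>.\<close>
    let ?h = "\<lambda>f. ((f a, f b), restrict f R)"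
    have "inj_on ?h {f \<in> mono_maps P. f m = p}"
    proof (rule inj_onI)
      fix f g assume f: "f \<in> {f \<in> mono_maps P. f m = p}" and g: "g \<in> {f \<in> mono_maps P. f m = p}"
        and eq: "?h f = ?h g"
      have "f x = g x" for x
      proof -
        consider "x \<in> R" | "x \<in> {m, a, b}" | "x \<notin> P" by (auto simp: R_def)
        thus ?thesis
        proof cases
          case 1
          thus ?thesis using eq by (metis prod.inject restrict_apply')
        next
          case 2
          thus ?thesis using eq f g by auto
        next
          case 3
          thus ?thesis using f g by (auto simp: mono_maps_def PiE_iff extensional_def)
        qed
      qed
      thus "f = g" by blast
    qed
    moreover have "?h ` {f \<in> mono_maps P. f m = p} \<subseteq> cmp p \<times> (R \<rightarrow>\<^sub>E up p)"
    proof (rule image_subsetI)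
      fix f assume f: "f \<in> {f \<in> mono_maps P. f m = p}"
      have "f x \<in> up p" if "x \<in> P" for x
        using f that m by (auto simp: mono_maps_def up_def)
      moreover have "f a \<le> f b" using f ab by (auto simp: mono_maps_def)
      ultimately show "?h f \<in> cmp p \<times> (R \<rightarrow>\<^sub>E up p)"
        using ab by (auto simp: cmp_def R_def)
    qed
    moreover have "finite (cmp p \<times> (R \<rightarrow>\<^sub>E up p))"
      using fincmp finup P by (auto simp: R_def intro: finite_PiE)
    ultimately have "card {f \<in> mono_maps P. f m = p} \<le> card (cmp p \<times> (R \<rightarrow>\<^sub>E up p))"
      by (rule card_inj_on_le)
    also have "\<dots> = card (cmp p) * card (up p) ^ (n - 3)"
      using P by (simp add: card_cartesian_product card_funcsetE R_def flip: cardR)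
    finally have "2 * card {f \<in> mono_maps P. f m = p} \<le> (2 * card (cmp p)) * card (up p) ^ (n - 3)"
      by simp
    also have "\<dots> \<le> (card (up p) * (card (up p) + 1)) * card (up p) ^ (n - 3)"
      unfolding cmp_def by (intro mult_right_mono card_comparable_pairs_le finup) simp
    also have "\<dots> = (card (up p) + 1) * card (up p) ^ Suc (n - 3)"
      by (simp only: power_Suc ac_simps)
    also have "Suc (n - 3) = n - 2" using n3 by simp
    finally show ?thesis .
  qed
  have "mono_maps P = (\<Union>p\<in>P. {f \<in> mono_maps P. f m = p})"
    using m by (auto simp: mono_maps_def)
  hence "card (mono_maps P) \<le> (\<Sum>p\<in>P. card {f \<in> mono_maps P. f m = p})"
    using card_UN_le[OF P, of "\<lambda>p. {f \<in> mono_maps P. f m = p}"] by simp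
  hence "2 * card (mono_maps P) \<le> (\<Sum>p\<in>P. 2 * card {f \<in> mono_maps P. f m = p})"
    by (simp flip: sum_distrib_left)
  also have "\<dots> \<le> (\<Sum>p\<in>P. (card (up p) + 1) * card (up p) ^ (n - 2))"
    by (rule sum_mono) (rule fibre)
  also have "\<dots> \<le> (\<Sum>j=1..n. (j + 1) * j ^ (n - 2))"
    unfolding n_def up_def
    by (rule sum_card_upset_le[OF P]) (auto simp: mono_def intro!: mult_mono add_mono power_mono)
  also have "\<dots> < 2 * (n ^ (n - 1) + n - 1)"
  proof -
    \<comment> \<open>The shift \<open>n = k + 3\<close> turns the exponent \<open>n - 2\<close>
      into \<open>k + 1\<close>, the form treated in \<open>sum_power_less\<close>.\<close>
    obtain k where "n = k + 3" using n3 by (metis le_add_diff_inverse2)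
    thus ?thesis using sum_power_less[of k] by (simp add: numeral_eq_Suc)
  qed
  finally show ?thesis by (simp add: n_def)
qed

lemma card_mono_maps_dichotomy:
  fixes P :: "'b::order set"
  assumes "finite P" and "m \<in> P" and "\<And>x. x \<in> P \<Longrightarrow> m \<le> x"
  shows "card (mono_maps P) < card P ^ (card P - 1) + card P - 1
       \<or> mono_maps P \<subseteq> fixing_or_const P m"
  using card_mono_maps_less[OF assms] mono_maps_subset_fixing_or_const[OF assms(2,3)] by blast

section \<open>Transition semigroups\<close>

text \<open>Restriction to \<open>S\<close> identifies words that act alike on states. The empty
  word is excluded, so the identity occurs only if a nonempty word induces it.\<close>

definition word_maps :: "'a set \<Rightarrow> ('a \<Rightarrow> 's \<Rightarrow> 's) \<Rightarrow> 's set \<Rightarrow> ('s \<Rightarrow> 's) set" where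
  "word_maps \<Sigma> \<delta> S = (\<lambda>w. restrict (fold \<delta> w) S) ` (lists \<Sigma> - {[]})"

text \<open>The classes of the kernel of \<open>f\<close> are its nonempty fibres, one for each
  value.\<close>

lemma card_quotient_kernel:
  "card (A // {(x, y). x \<in> A \<and> y \<in> A \<and> f x = f y}) = card (f ` A)"
proof -
  let ?fib = "\<lambda>y. {x \<in> A. f x = y}"
  have "A // {(x, y). x \<in> A \<and> y \<in> A \<and> f x = f y} = ?fib ` (f ` A)"
    unfolding quotient_def by force
  moreover have "inj_on ?fib (f ` A)" by (rule inj_onI) blast
  ultimately show ?thesis by (simp add: card_image)
qed

lemma fold_closed:
  assumes "\<And>a q. a \<in> \<Sigma> \<Longrightarrow> q \<in> S \<Longrightarrow> \<delta> a q \<in> S" and "w \<in> lists \<Sigma>" and "q \<in> S"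
  shows "fold \<delta> w q \<in> S"
  using assms(2,3) by (induction w arbitrary: q) (auto intro: assms(1))

text \<open>All states are reachable and distinct states are separated, so the automaton is minimal:
  states correspond to quotients, and syntactic classes to induced state maps.\<close>

lemma dfa_kappa_sigma:
  fixes \<delta> :: "'a \<Rightarrow> 's \<Rightarrow> 's"
  assumes S: "S = (\<lambda>w. fold \<delta> w q0) ` lists \<Sigma>"
    and L: "L = {w \<in> lists \<Sigma>. fold \<delta> w q0 \<in> F}"
    and sep: "\<And>p q. p \<in> S \<Longrightarrow> q \<in> S \<Longrightarrow>
        (\<And>v. v \<in> lists \<Sigma> \<Longrightarrow> fold \<delta> v p \<in> F \<longleftrightarrow> fold \<delta> v q \<in> F) \<Longrightarrow> p = q"
  shows "kappa \<Sigma> L = card S" and "sigma \<Sigma> L = card (word_maps \<Sigma> \<delta> S)"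
proof -
  have step: "fold \<delta> w q \<in> S" if w: "w \<in> lists \<Sigma>" and q: "q \<in> S" for w q
  proof -
    from q S obtain u where "u \<in> lists \<Sigma>" "q = fold \<delta> u q0" by auto
    hence "u @ w \<in> lists \<Sigma>" "fold \<delta> w q = fold \<delta> (u @ w) q0" using w by auto
    thus ?thesis unfolding S by (metis imageI)
  qed
  define lang where "lang q = {v \<in> lists \<Sigma>. fold \<delta> v q \<in> F}" for q
  have "quotient_lang w L = lang (fold \<delta> w q0)" if "w \<in> lists \<Sigma>" for w
    using that by (auto simp: quotient_lang_def L lang_def)
  hence "{quotient_lang w L | w. w \<in> lists \<Sigma>} = lang ` S"
    unfolding S by auto
  moreover have "inj_on lang S"
    by (rule inj_onI, rule sep) (auto simp: lang_def set_eq_iff)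
  ultimately show "kappa \<Sigma> L = card S" by (simp add: kappa_def card_image)
  have cong: "synt_cong \<Sigma> L x y \<longleftrightarrow> restrict (fold \<delta> x) S = restrict (fold \<delta> y) S"
    if x: "x \<in> lists \<Sigma>" and y: "y \<in> lists \<Sigma>" for x y
  proof -
    \<comment> \<open>The left context \<open>u\<close> leads to an arbitrary state, the right
      context \<open>v\<close> tests the outcome, and separation turns equal tests into equal
      states.\<close>
    have "synt_cong \<Sigma> L x y \<longleftrightarrow> (\<forall>q\<in>S. \<forall>v\<in>lists \<Sigma>.
        fold \<delta> v (fold \<delta> x q) \<in> F \<longleftrightarrow> fold \<delta> v (fold \<delta> y q) \<in> F)"
      unfolding synt_cong_def S L using x y by auto
    also have "\<dots> \<longleftrightarrow> (\<forall>q\<in>S. fold \<delta> x q = fold \<delta> y q)"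
      using sep step x y by metis
    also have "\<dots> \<longleftrightarrow> restrict (fold \<delta> x) S = restrict (fold \<delta> y) S"
      by (metis restrict_apply' restrict_ext)
    finally show ?thesis .
  qed
  have "{(x, y). x \<in> lists \<Sigma> - {[]} \<and> y \<in> lists \<Sigma> - {[]} \<and> synt_cong \<Sigma> L x y}
      = {(x, y). x \<in> lists \<Sigma> - {[]} \<and> y \<in> lists \<Sigma> - {[]} \<and>
          restrict (fold \<delta> x) S = restrict (fold \<delta> y) S}"
    using cong by blast
  thus "sigma \<Sigma> L = card (word_maps \<Sigma> \<delta> S)"
    unfolding sigma_def word_maps_def by (simp only: card_quotient_kernel)
qed

section \<open>The automaton of quotients\<close>

definition quotients :: "'a set \<Rightarrow> 'a list set \<Rightarrow> 'a list set set" where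
  "quotients \<Sigma> L = (\<lambda>w. quotient_lang w L) ` lists \<Sigma>"

abbreviation letter_quotient :: "'a \<Rightarrow> 'a list set \<Rightarrow> 'a list set" where
  "letter_quotient a \<equiv> quotient_lang [a]"

lemma fold_letter_quotient: "fold letter_quotient w L = quotient_lang w L"
  by (induction w arbitrary: L) (auto simp: quotient_lang_def)

lemma letter_quotient_closed:
  assumes "a \<in> \<Sigma>" and "q \<in> quotients \<Sigma> L"
  shows "letter_quotient a q \<in> quotients \<Sigma> L"
proof -
  from assms(2) obtain w where "w \<in> lists \<Sigma>" "q = quotient_lang w L" by (auto simp: quotients_def)
  hence "letter_quotient a q = quotient_lang (w @ [a]) L" "w @ [a] \<in> lists \<Sigma>"
    using assms(1) by (auto simp: quotient_lang_def)
  thus ?thesis by (auto simp: quotients_def)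
qed

text \<open>Quotients under \<open>letter_quotient\<close>, started at \<open>L\<close> and
  accepting when they contain the empty word, form the canonical minimal automaton. Each quotient is
  the language accepted from it as a state, which gives separation.\<close>

lemma quotient_dfa:
  assumes "L \<subseteq> lists \<Sigma>"
  shows "kappa \<Sigma> L = card (quotients \<Sigma> L)"
    and "sigma \<Sigma> L = card (word_maps \<Sigma> letter_quotient (quotients \<Sigma> L))"
proof -
  have S: "quotients \<Sigma> L = (\<lambda>w. fold letter_quotient w L) ` lists \<Sigma>"
    by (simp add: quotients_def fold_letter_quotient)
  have L: "L = {w \<in> lists \<Sigma>. fold letter_quotient w L \<in> {q. [] \<in> q}}"
    using assms by (auto simp: fold_letter_quotient quotient_lang_def)
  have sep: "p = q" if pq: "p \<in> quotients \<Sigma> L" "q \<in> quotients \<Sigma> L"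
    and eq: "\<And>v. v \<in> lists \<Sigma> \<Longrightarrow>
      fold letter_quotient v p \<in> {q. [] \<in> q} \<longleftrightarrow> fold letter_quotient v q \<in> {q. [] \<in> q}" for p q
  proof -
    have "p \<subseteq> lists \<Sigma>" "q \<subseteq> lists \<Sigma>"
      using pq assms by (auto simp: quotients_def quotient_lang_def)
    moreover have "v \<in> p \<longleftrightarrow> v \<in> q" if "v \<in> lists \<Sigma>" for v
      using eq[OF that] by (simp add: fold_letter_quotient quotient_lang_def)
    ultimately show ?thesis by blast
  qed
  show "kappa \<Sigma> L = card (quotients \<Sigma> L)" by (rule dfa_kappa_sigma(1)[OF S L sep])
  show "sigma \<Sigma> L = card (word_maps \<Sigma> letter_quotient (quotients \<Sigma> L))"
    by (rule dfa_kappa_sigma(2)[OF S L sep])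
qed

lemma left_idealI:
  assumes "L \<noteq> {}" and "\<And>u v. u \<in> lists \<Sigma> \<Longrightarrow> v \<in> L \<Longrightarrow> u @ v \<in> L"
  shows "left_ideal \<Sigma> L"
proof -
  have "v \<in> {u @ v | u v. u \<in> lists \<Sigma> \<and> v \<in> L}" if "v \<in> L" for v
    using that by (intro CollectI exI[of _ "[]"] exI[of _ v]) simp
  hence "L = {u @ v | u v. u \<in> lists \<Sigma> \<and> v \<in> L}"
    using assms(2) by (intro equalityI subsetI) (assumption | blast)+
  with assms(1) show ?thesis unfolding left_ideal_def by (rule conjI)
qed

lemma left_ideal_append:
  assumes "left_ideal \<Sigma> L" and "u \<in> lists \<Sigma>" and "v \<in> L"
  shows "u @ v \<in> L"
  using assms unfolding left_ideal_def by blast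

text \<open>Prepending a word keeps \<open>L\<close> inside itself, so every quotient contains
  \<open>L\<close>; quotients preserve inclusion, so words act monotonically. Attaining the bound
  rules out the strict case of the dichotomy, and then cardinalities force equality.\<close>

lemma left_ideal_sigma:
  assumes LS: "L \<subseteq> lists \<Sigma>" and li: "left_ideal \<Sigma> L" and n: "kappa \<Sigma> L = n" "n \<ge> 1"
  shows "sigma \<Sigma> L \<le> n ^ (n - 1) + n - 1"
    and "sigma \<Sigma> L = n ^ (n - 1) + n - 1 \<Longrightarrow>
      word_maps \<Sigma> letter_quotient (quotients \<Sigma> L) = fixing_or_const (quotients \<Sigma> L) L"
proof -
  let ?Q = "quotients \<Sigma> L" and ?T = "word_maps \<Sigma> letter_quotient (quotients \<Sigma> L)"
  have card: "card ?Q = n" and sig: "sigma \<Sigma> L = card ?T"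
    using quotient_dfa[OF LS] n by auto
  \<comment> \<open>An infinite set has \<open>card\<close> 0, so \<open>n \<ge> 1\<close> yields
    finiteness.\<close>
  have fin: "finite ?Q" using card n(2) by (metis card.infinite not_one_le_zero)
  have LQ: "L \<in> ?Q" unfolding quotients_def
    by (rule image_eqI[of _ _ "[]"]) (auto simp: quotient_lang_def)
  have least: "L \<le> q" if "q \<in> ?Q" for q
    using that left_ideal_append[OF li] by (auto simp: quotients_def quotient_lang_def)
  have sub: "?T \<subseteq> mono_maps ?Q"
  proof
    fix f assume "f \<in> ?T"
    then obtain w where w: "w \<in> lists \<Sigma>" "f = restrict (fold letter_quotient w) ?Q"
      by (auto simp: word_maps_def)
    have "fold letter_quotient w q \<in> ?Q" if "q \<in> ?Q" for q
      using fold_closed[OF letter_quotient_closed w(1) that] by simp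
    thus "f \<in> mono_maps ?Q"
      by (auto simp: mono_maps_def w(2) fold_letter_quotient quotient_lang_def)
  qed
  have le: "card ?T \<le> card (mono_maps ?Q)"
    using card_mono[OF finite_mono_maps[OF fin] sub] .
  have cardW: "card (fixing_or_const ?Q L) = n ^ (n - 1) + n - 1"
    using card_fixing_or_const[OF fin LQ] card by simp
  have alt: "card (mono_maps ?Q) < n ^ (n - 1) + n - 1 \<or> mono_maps ?Q \<subseteq> fixing_or_const ?Q L"
    using card_mono_maps_dichotomy[OF fin LQ least] card by simp
  show "sigma \<Sigma> L \<le> n ^ (n - 1) + n - 1"
    using alt le sig cardW card_mono[OF finite_fixing_or_const[OF fin], of "mono_maps ?Q" L]
    by linarith
  assume eq: "sigma \<Sigma> L = n ^ (n - 1) + n - 1"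
  hence "?T \<subseteq> fixing_or_const ?Q L" using alt le sig sub by auto
  thus "?T = fixing_or_const ?Q L"
    using card_subset_eq[OF finite_fixing_or_const[OF fin]] eq sig cardW by metis
qed

section \<open>Complements and the full language\<close>

text \<open>A word with a suffix outside \<open>L\<close> is itself outside \<open>L\<close>. The
  full language is excluded since its complement is empty and a left ideal is not.\<close>

lemma left_ideal_complement:
  assumes "L \<subseteq> lists \<Sigma>" and "suffix_closed L" and "L \<noteq> lists \<Sigma>"
  shows "left_ideal \<Sigma> (lists \<Sigma> - L)"
proof (rule left_idealI)
  show "lists \<Sigma> - L \<noteq> {}" using assms(1,3) by blast
  fix u v assume "u \<in> lists \<Sigma>" "v \<in> lists \<Sigma> - L"
  thus "u @ v \<in> lists \<Sigma> - L" using assms(2) by (auto simp: suffix_closed_def)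
qed

lemma suffix_closed_complement:
  assumes "left_ideal \<Sigma> L"
  shows "suffix_closed (lists \<Sigma> - L)"
  using left_ideal_append[OF assms] by (fastforce simp: suffix_closed_def in_lists_conv_set)

lemma kappa_complement:
  assumes "L \<subseteq> lists \<Sigma>"
  shows "kappa \<Sigma> (lists \<Sigma> - L) = kappa \<Sigma> L"
proof -
  let ?c = "\<lambda>q. lists \<Sigma> - q"
  have "quotient_lang w (lists \<Sigma> - L) = ?c (quotient_lang w L)" if "w \<in> lists \<Sigma>" for w
    using that by (auto simp: quotient_lang_def)
  hence "{quotient_lang w (lists \<Sigma> - L) | w. w \<in> lists \<Sigma>} = ?c ` {quotient_lang w L | w. w \<in> lists \<Sigma>}"
    by auto
  moreover have "inj_on ?c {quotient_lang w L | w. w \<in> lists \<Sigma>}"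
  proof (rule inj_onI)
    fix p q assume "p \<in> {quotient_lang w L | w. w \<in> lists \<Sigma>}" "q \<in> {quotient_lang w L | w. w \<in> lists \<Sigma>}"
    hence "p \<subseteq> lists \<Sigma>" "q \<subseteq> lists \<Sigma>" using assms by (auto simp: quotient_lang_def)
    thus "?c p = ?c q \<Longrightarrow> p = q" by blast
  qed
  ultimately show ?thesis by (simp add: kappa_def card_image)
qed

lemma sigma_complement: "sigma \<Sigma> (lists \<Sigma> - L) = sigma \<Sigma> L"
proof -
  have "{(x, y). x \<in> lists \<Sigma> - {[]} \<and> y \<in> lists \<Sigma> - {[]} \<and> synt_cong \<Sigma> (lists \<Sigma> - L) x y}
      = {(x, y). x \<in> lists \<Sigma> - {[]} \<and> y \<in> lists \<Sigma> - {[]} \<and> synt_cong \<Sigma> L x y}"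
    by (auto simp: synt_cong_def)
  thus ?thesis by (simp add: sigma_def)
qed

lemma kappa_lists: "kappa \<Sigma> (lists \<Sigma>) = 1"
proof -
  have "{quotient_lang w (lists \<Sigma>) | w. w \<in> lists \<Sigma>} = {lists \<Sigma>}"
    by (auto simp: quotient_lang_def intro!: exI[of _ "[]"])
  thus ?thesis by (simp add: kappa_def)
qed

lemma left_ideal_lists: "left_ideal \<Sigma> (lists \<Sigma>)"
  by (rule left_idealI) auto

lemma sigma_lists:
  assumes "\<Sigma> \<noteq> {}"
  shows "sigma \<Sigma> (lists \<Sigma>) = 1"
proof -
  \<comment> \<open>Writing the total relation as the kernel of a constant map makes
    \<open>card_quotient_kernel\<close> applicable.\<close>
  have "{(x, y). x \<in> lists \<Sigma> - {[]} \<and> y \<in> lists \<Sigma> - {[]} \<and> synt_cong \<Sigma> (lists \<Sigma>) x y}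
     = {(x, y). x \<in> lists \<Sigma> - {[]} \<and> y \<in> lists \<Sigma> - {[]} \<and> () = ()}"
    by (auto simp: synt_cong_def)
  hence "sigma \<Sigma> (lists \<Sigma>) = card ((\<lambda>_. ()) ` (lists \<Sigma> - {[]}))"
    unfolding sigma_def by (simp only: card_quotient_kernel)
  moreover from assms obtain a where "a \<in> \<Sigma>" by blast
  hence "[a] \<in> lists \<Sigma> - {[]}" by simp
  hence "lists \<Sigma> - {[]} \<noteq> {}" by blast
  ultimately show ?thesis by (simp only: image_constant_conv if_False) simp
qed

section \<open>Lower bound on the alphabet\<close>

lemma fold_replicate: "fold \<delta> (replicate k a) = \<delta> a ^^ k"
  by (induction k) (auto simp: funpow_swap1 fun_eq_iff)

text \<open>The letters fall into four disjoint classes. For each class some map in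
  \<open>fixing_or_const S m\<close> is found that no word avoiding the class can induce;
  \<open>Mg\<close> enters from three states on, a second letter in \<open>Id\<close> from four
  on.\<close>

lemma card_alphabet_ge:
  fixes \<delta> :: "'a \<Rightarrow> 's \<Rightarrow> 's"
  assumes fin: "finite \<Sigma>" "finite S" and m: "m \<in> S" and n2: "card S \<ge> 2"
    and closed: "\<And>a q. a \<in> \<Sigma> \<Longrightarrow> q \<in> S \<Longrightarrow> \<delta> a q \<in> S"
    and gen: "word_maps \<Sigma> \<delta> S = fixing_or_const S m"
  shows "min_alph (card S) \<le> card \<Sigma>"
proof -
  \<comment> \<open>As \<open>S\<close> is finite, \<open>Id\<close> contains all letters acting as
    permutations that fix \<open>m\<close>, not just as the identity. The letters in
    \<open>Ct\<close> will turn out to be constant.\<close>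
  define Id where "Id = {a \<in> \<Sigma>. \<delta> a m = m \<and> inj_on (\<delta> a) S}"
  define Mg where "Mg = {a \<in> \<Sigma>. \<delta> a m = m \<and> \<not> inj_on (\<delta> a) S \<and> (\<forall>x\<in>S - {m}. \<delta> a x \<noteq> m)}"
  define Kl where "Kl = {a \<in> \<Sigma>. \<delta> a m = m \<and> (\<exists>x\<in>S - {m}. \<delta> a x = m)}"
  define Ct where "Ct = {a \<in> \<Sigma>. \<delta> a m \<noteq> m}"
  have disj: "Id \<inter> Mg = {}" "(Id \<union> Mg) \<inter> Kl = {}" "(Id \<union> Mg \<union> Kl) \<inter> Ct = {}"
    using m by (auto simp: Id_def Mg_def Kl_def Ct_def inj_on_def)
  have "finite Id" "finite Mg" "finite Kl" "finite Ct"
    using fin(1) by (auto simp: Id_def Mg_def Kl_def Ct_def)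
  hence "card (Id \<union> Mg \<union> Kl \<union> Ct) = card Id + card Mg + card Kl + card Ct"
    using disj by (simp add: card_Un_disjoint)
  moreover have "Id \<union> Mg \<union> Kl \<union> Ct \<subseteq> \<Sigma>" by (auto simp: Id_def Mg_def Kl_def Ct_def)
  ultimately have cardS: "card Id + card Mg + card Kl + card Ct \<le> card \<Sigma>"
    using card_mono[OF fin(1)] by metis
  have cover: "\<Sigma> \<subseteq> Id \<union> Mg \<union> Kl \<union> Ct" by (auto simp: Id_def Mg_def Kl_def Ct_def)

  have word: "\<exists>w\<in>lists \<Sigma> - {[]}. \<forall>x\<in>S. fold \<delta> w x = f x"
    if "f \<in> fixing_or_const S m" for f
  proof -
    from that gen obtain w where "w \<in> lists \<Sigma> - {[]}" "f = restrict (fold \<delta> w) S"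
      unfolding word_maps_def by blast
    thus ?thesis by auto
  qed
  have fixing: "\<exists>w\<in>lists \<Sigma> - {[]}. \<forall>x\<in>S. fold \<delta> w x = f x"
    if "\<And>x. x \<in> S \<Longrightarrow> f x \<in> S" and "f m = m" for f
  proof -
    have "restrict f S \<in> fixing_or_const S m" using that m by (auto simp: fixing_or_const_def)
    from word[OF this] show ?thesis by auto
  qed
  have const: "\<exists>c\<in>S - {m}. \<forall>x\<in>S. \<delta> a x = c" if a: "a \<in> Ct" for a
  proof -
    have "restrict (fold \<delta> [a]) S \<in> fixing_or_const S m"
      using a unfolding gen[symmetric] word_maps_def Ct_def by (intro imageI) auto
    hence "restrict (\<delta> a) S \<in> fixing_or_const S m" by simp
    moreover have "restrict (\<delta> a) S m \<noteq> m" using a m by (auto simp: Ct_def)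
    ultimately obtain c where "c \<in> S - {m}" "restrict (\<delta> a) S = (\<lambda>x\<in>S. c)"
      unfolding fixing_or_const_def by blast
    thus ?thesis by (metis restrict_apply')
  qed
  have const_word: "fold \<delta> w x = fold \<delta> w y"
    if "w \<in> lists \<Sigma>" "set w \<inter> Ct \<noteq> {}" "x \<in> S" "y \<in> S" for w x y
    using that
  proof (induction w arbitrary: x y rule: list.induct)
    case (Cons a w)
    show ?case
    proof (cases "a \<in> Ct")
      case True
      hence "\<delta> a x = \<delta> a y" using const Cons.prems by metis
      thus ?thesis by simp
    next
      case False
      hence "set w \<inter> Ct \<noteq> {}" using Cons.prems(2) by auto
      moreover have a: "a \<in> \<Sigma>" and "w \<in> lists \<Sigma>" using Cons.prems(1) by auto
      ultimately have "fold \<delta> w (\<delta> a x) = fold \<delta> w (\<delta> a y)"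
        using closed[OF a Cons.prems(3)] closed[OF a Cons.prems(4)] by (intro Cons.IH)
      thus ?thesis by simp
    qed
  qed simp
  have fix_word: "fold \<delta> w m = m" if "w \<in> lists \<Sigma>" "set w \<inter> Ct = {}" for w
    using that by (induction w) (auto simp: Ct_def)

  obtain x where x: "x \<in> S" "x \<noteq> m"
  proof -
    have "S \<noteq> {m}" using n2 by auto
    thus ?thesis using m that by blast
  qed

  \<comment> \<open>Without \<open>Ct\<close> every word fixes \<open>m\<close>, so no constant
    other than \<open>m\<close> arises.\<close>
  have "Ct \<noteq> {}"
  proof
    assume E: "Ct = {}"
    have "(\<lambda>y\<in>S. x) \<in> fixing_or_const S m" using x by (auto simp: fixing_or_const_def)
    from word[OF this] obtain w where "w \<in> lists \<Sigma>" "fold \<delta> w m = x" using m by auto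
    thus False using fix_word[of w] E x by auto
  qed

  \<comment> \<open>Without \<open>Kl\<close> the states other than \<open>m\<close> are invariant
    under every letter, constant letters included, so the constant map to \<open>m\<close> cannot
    arise.\<close>
  have "Kl \<noteq> {}"
  proof
    assume K: "Kl = {}"
    have avoid: "fold \<delta> w y \<noteq> m" if "w \<in> lists \<Sigma>" "y \<in> S" "y \<noteq> m" for w y
      using that
    proof (induction w arbitrary: y rule: list.induct)
      case (Cons a w)
      have "\<delta> a y \<noteq> m"
      proof (cases "a \<in> Ct")
        case True
        then obtain c where "c \<in> S - {m}" "\<forall>x\<in>S. \<delta> a x = c" using const by blast
        thus ?thesis using Cons.prems by simp
      next
        case False thus ?thesis using K Cons.prems by (auto simp: Ct_def Kl_def)
      qed
      moreover have a: "a \<in> \<Sigma>" and "w \<in> lists \<Sigma>" using Cons.prems(1) by auto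
      ultimately have "fold \<delta> w (\<delta> a y) \<noteq> m"
        using closed[OF a Cons.prems(2)] by (intro Cons.IH)
      thus ?case by simp
    qed simp
    obtain w where "w \<in> lists \<Sigma>" "fold \<delta> w x = m" using fixing[of "\<lambda>_. m"] m x by auto
    thus False using avoid x by blast
  qed

  \<comment> \<open>The first letter of an injective word is injective, hence a permutation by
    finiteness, so the rest of the word is injective on all of \<open>S\<close>.\<close>
  have inj_letters: "w \<in> lists Id" if "w \<in> lists \<Sigma>" "inj_on (fold \<delta> w) S" for w
    using that
  proof (induction w rule: list.induct)
    case (Cons a w)
    have "inj_on (fold \<delta> w \<circ> \<delta> a) S" using Cons.prems by (simp add: comp_def)
    hence inja: "inj_on (\<delta> a) S" by (rule inj_on_imageI2)
    have "\<delta> a ` S \<subseteq> S" using closed Cons.prems by auto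
    hence img: "\<delta> a ` S = S" using inja fin(2) by (simp add: endo_inj_surj)
    have "\<delta> a m = m"
    proof (rule ccontr)
      assume "\<delta> a m \<noteq> m"
      hence "a \<in> Ct" using Cons.prems by (auto simp: Ct_def)
      hence "\<delta> a x = \<delta> a m" using const x m by metis
      thus False using inja x m by (auto simp: inj_on_def)
    qed
    moreover have "inj_on (fold \<delta> w) S"
      using \<open>inj_on (fold \<delta> w \<circ> \<delta> a) S\<close> img by (metis inj_on_imageI)
    ultimately show ?case using Cons inja by (auto simp: Id_def)
  qed simp
  have inj_word: "\<exists>w\<in>lists Id - {[]}. \<forall>x\<in>S. fold \<delta> w x = f x"
    if f: "\<And>x. x \<in> S \<Longrightarrow> f x \<in> S" "f m = m" "inj_on f S" for f
  proof -
    from fixing[of f] f obtain w where w: "w \<in> lists \<Sigma> - {[]}" "\<forall>x\<in>S. fold \<delta> w x = f x" by blast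
    hence "inj_on (fold \<delta> w) S" using f(3) by (auto simp: inj_on_def)
    thus ?thesis using inj_letters w by blast
  qed
  \<comment> \<open>The identity map must come from a nonempty word, all of whose letters are in
    \<open>Id\<close>.\<close>
  have "Id \<noteq> {}"
    using inj_word[of "\<lambda>x. x"] by (auto simp: lists_empty)

  \<comment> \<open>Without \<open>Mg\<close>, in a word free of constant letters the first letter
    that is not a permutation sends a state other than \<open>m\<close> to \<open>m\<close>, which
    then stays there. The map sending \<open>y\<close> to \<open>x\<close> and fixing all else
    escapes both alternatives.\<close>
  have Mg: "Mg \<noteq> {}" if n3: "card S \<ge> 3"
  proof
    assume M: "Mg = {}"
    have alt: "inj_on (fold \<delta> w) S \<or> (\<exists>x\<in>S - {m}. fold \<delta> w x = m)"
      if "w \<in> lists \<Sigma>" "set w \<inter> Ct = {}" for w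
      using that
    proof (induction w rule: rev_induct)
      case (snoc a w)
      have a: "a \<in> \<Sigma>" "\<delta> a m = m" using snoc.prems by (auto simp: Ct_def)
      have w: "w \<in> lists \<Sigma>" "set w \<inter> Ct = {}" using snoc.prems by auto
      from snoc.IH[OF w] show ?case
      proof
        assume "\<exists>x\<in>S - {m}. fold \<delta> w x = m"
        thus ?thesis using a by auto
      next
        assume inj: "inj_on (fold \<delta> w) S"
        have "fold \<delta> w ` S \<subseteq> S" using fold_closed[of \<Sigma> S \<delta>] closed w by blast
        hence img: "fold \<delta> w ` S = S" using inj fin(2) by (simp add: endo_inj_surj)
        show ?thesis
        proof (cases "a \<in> Id")
          case True
          hence "inj_on (\<delta> a \<circ> fold \<delta> w) S" using inj img by (auto simp: Id_def intro: comp_inj_on)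
          thus ?thesis by (simp add: comp_def)
        next
          case False
          hence "a \<in> Kl" using M a cover snoc.prems by auto
          then obtain y where y: "y \<in> S" "y \<noteq> m" "\<delta> a y = m" by (auto simp: Kl_def)
          hence "y \<in> fold \<delta> w ` S" using img by simp
          then obtain z where z: "z \<in> S" "fold \<delta> w z = y" by (elim imageE) simp
          hence "z \<noteq> m" using y fix_word[OF w] by auto
          thus ?thesis using y z by (intro disjI2 bexI[of _ z]) auto
        qed
      qed
    qed simp
    have "card {m, x} \<le> 2" by (simp add: card_insert_if)
    hence "\<not> S \<subseteq> {m, x}" using n3 card_mono[of "{m, x}" S] by auto
    then obtain y where y: "y \<in> S" "y \<noteq> m" "y \<noteq> x" by blast
    have "\<exists>w\<in>lists \<Sigma> - {[]}. \<forall>z\<in>S. fold \<delta> w z = (if z = y then x else z)"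
      by (rule fixing) (use x y in auto)
    then obtain w where w: "w \<in> lists \<Sigma>" "\<forall>z\<in>S. fold \<delta> w z = (if z = y then x else z)"
      by blast
    have "set w \<inter> Ct = {}" using const_word[of w m x] w x y m by auto
    from alt[OF w(1) this] show False
    proof
      assume "inj_on (fold \<delta> w) S"
      moreover have "fold \<delta> w x = fold \<delta> w y" using w(2) x y by simp
      ultimately show False using x y by (metis inj_onD)
    next
      assume "\<exists>x\<in>S - {m}. fold \<delta> w x = m"
      then obtain z where "z \<in> S" "z \<noteq> m" "fold \<delta> w z = m" by blast
      moreover from this have "m = (if z = y then x else z)" using w(2) by simp
      ultimately show False using x by (simp split: if_splits)
    qed
  qed

  \<comment> \<open>Powers of a single letter commute, but the transpositions of \<open>x\<close>,
    \<open>y\<close> and of \<open>y\<close>, \<open>z\<close> do not. Four states provide three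
    besides \<open>m\<close>.\<close>
  have Id2: "card Id \<ge> 2" if n4: "card S \<ge> 4"
  proof (rule ccontr)
    assume "\<not> card Id \<ge> 2"
    moreover have "card Id \<noteq> 0" using \<open>Id \<noteq> {}\<close> \<open>finite Id\<close> by simp
    ultimately have "card Id = 1" by linarith
    then obtain a where Id: "Id = {a}" by (auto simp: card_1_singleton_iff)
    have "card {m, x} \<le> 2" by (simp add: card_insert_if)
    hence "\<not> S \<subseteq> {m, x}" using n4 card_mono[of "{m, x}" S] by auto
    then obtain y where y: "y \<in> S" "y \<noteq> m" "y \<noteq> x" by blast
    have "card {m, x, y} \<le> 3" by (simp add: card_insert_if)
    hence "\<not> S \<subseteq> {m, x, y}" using n4 card_mono[of "{m, x, y}" S] by auto
    then obtain z where z: "z \<in> S" "z \<noteq> m" "z \<noteq> x" "z \<noteq> y" by blast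
    have power: "\<exists>k. \<forall>q\<in>S. (\<delta> a ^^ k) q = f q"
      if f: "\<And>x. x \<in> S \<Longrightarrow> f x \<in> S" "f m = m" "inj_on f S" for f
    proof -
      from inj_word[OF f] Id obtain w where w: "w \<in> lists {a}" "\<forall>x\<in>S. fold \<delta> w x = f x" by blast
      hence "w = replicate (length w) a" by (auto intro: replicate_eqI)
      hence "fold \<delta> w = \<delta> a ^^ length w" using fold_replicate by metis
      thus ?thesis using w by metis
    qed
    have "\<exists>k. \<forall>q\<in>S. (\<delta> a ^^ k) q = transpose x y q"
      by (rule power) (use x y in \<open>auto simp: transpose_def inj_on_def\<close>)
    then obtain k where k: "\<forall>q\<in>S. (\<delta> a ^^ k) q = transpose x y q" by blast
    have "\<exists>k. \<forall>q\<in>S. (\<delta> a ^^ k) q = transpose y z q"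
      by (rule power) (use y z in \<open>auto simp: transpose_def inj_on_def\<close>)
    then obtain l where l: "\<forall>q\<in>S. (\<delta> a ^^ l) q = transpose y z q" by blast
    have "(\<delta> a ^^ (k + l)) x = (\<delta> a ^^ k) x"
      using l x y z by (simp add: funpow_add transpose_def)
    moreover have "(\<delta> a ^^ (l + k)) x = (\<delta> a ^^ l) y"
      using k x y z by (simp add: funpow_add transpose_def)
    ultimately have "transpose x y x = transpose y z y"
      using k l x y by (simp add: add.commute)
    thus False using z by simp
  qed

  have "card Id \<ge> 1" "card Kl \<ge> 1" "card Ct \<ge> 1"
    using \<open>Id \<noteq> {}\<close> \<open>Kl \<noteq> {}\<close> \<open>Ct \<noteq> {}\<close> \<open>finite Id\<close> \<open>finite Kl\<close> \<open>finite Ct\<close>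
    by (auto simp: Suc_le_eq card_gt_0_iff)
  moreover have "card Mg \<ge> 1" if "card S \<ge> 3"
    using Mg[OF that] \<open>finite Mg\<close> by (auto simp: Suc_le_eq card_gt_0_iff)
  \<comment> \<open>The counts add up to 3 letters for two states, 4 for three and 5 from four
    on.\<close>
  ultimately show ?thesis using cardS Id2 n2 by (auto simp: min_alph_def)
qed

section \<open>Generators and witnesses\<close>

text \<open>This is the cycle \<open>(1 2 ... n-1)\<close>. The point 0, in the role of the least
  quotient, and all points from \<open>n\<close> on stay fixed.\<close>

definition cyc :: "nat \<Rightarrow> nat \<Rightarrow> nat" where
  "cyc n x = (if x \<in> {1..<n} then x mod (n - 1) + 1 else x)"

text \<open>For \<open>n = 3\<close> the cycle and the transposition coincide, and for \<open>n = 2\<close> the cycle is the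
  identity, so that \<open>gens n\<close> has at most \<open>min_alph n\<close> elements.\<close>

definition gens :: "nat \<Rightarrow> (nat \<Rightarrow> nat) set" where
  "gens n = {cyc n, id(n - 1 := 0), \<lambda>_. 1} \<union>
     (if n \<ge> 3 then {transpose 1 2, id(n - 1 := 1)} else {})"

lemma card_gens:
  assumes "n \<ge> 2"
  shows "finite (gens n)" and "card (gens n) \<le> min_alph n"
proof -
  show "finite (gens n)" by (simp add: gens_def)
  consider "n = 2" | "n = 3" | "n \<ge> 4" using assms by linarith
  thus "card (gens n) \<le> min_alph n"
  proof cases
    case 1
    thus ?thesis by (simp add: gens_def min_alph_def card_insert_if)
  next
    case 2
    have "cyc 3 x = transpose 1 2 x" for x
    proof -
      consider "x = 0" | "x = 1" | "x = 2" | "x \<ge> 3" by linarith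
      thus ?thesis by cases (auto simp: cyc_def transpose_def)
    qed
    hence "cyc 3 = transpose 1 2" by blast
    hence "gens n = {transpose 1 2, id(n - 1 := 0), \<lambda>_. 1, id(n - 1 := 1)}"
      using 2 by (auto simp: gens_def)
    thus ?thesis using 2 by (simp add: min_alph_def card_insert_if)
  next
    case 3
    thus ?thesis by (simp add: gens_def min_alph_def card_insert_if)
  qed
qed

lemma gens_closed:
  assumes "n \<ge> 2" and "g \<in> gens n" and "x < n"
  shows "g x < n"
proof -
  have "cyc n x < n"
  proof -
    have "x mod (n - 1) < n - 1" using assms(1) by simp
    thus ?thesis using assms(3) by (simp add: cyc_def less_diff_conv)
  qed
  thus ?thesis using assms by (auto simp: gens_def transpose_def split: if_splits)
qed

lemma gens_fixing_or_const:
  assumes "n \<ge> 2" and "g \<in> gens n"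
  shows "g 0 = 0 \<or> g = (\<lambda>_. 1)"
  using assms by (auto simp: gens_def cyc_def transpose_def split: if_splits)

text \<open>Shifted down by one, the cycle is the addition of 1 modulo \<open>n - 1\<close>.\<close>

lemma cyc_power:
  assumes "n \<ge> 2" and "x \<in> {1..<n}"
  shows "(cyc n ^^ k) x = (x - 1 + k) mod (n - 1) + 1"
proof (induction k)
  case 0
  have "x - 1 < n - 1" using assms by auto
  thus ?case using assms by simp
next
  case (Suc k)
  have "(x - 1 + k) mod (n - 1) < n - 1" using assms by simp
  hence "(x - 1 + k) mod (n - 1) + 1 \<in> {1..<n}" by auto
  thus ?case using Suc by (simp add: cyc_def mod_Suc_eq)
qed

lemma cyc_power_eq_id:
  assumes "n \<ge> 2"
  shows "cyc n ^^ (n - 1) = id"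
proof
  fix x
  show "(cyc n ^^ (n - 1)) x = id x"
  proof (cases "x \<in> {1..<n}")
    case True
    hence "x - 1 < n - 1" by auto
    hence "(x - 1 + (n - 1)) mod (n - 1) = x - 1" by (simp only: mod_add_self2 mod_less)
    hence "(cyc n ^^ (n - 1)) x = x - 1 + 1" by (simp only: cyc_power[OF assms True])
    thus ?thesis using True by simp
  next
    case False
    have "(cyc n ^^ k) x = x" for k using False by (induction k) (auto simp: cyc_def)
    thus ?thesis by simp
  qed
qed

text \<open>Conjugating a transposition by \<open>f\<close> moves its two points by
  \<open>f\<close>; the identity is put in a form without inverses.\<close>

lemma inj_comp_transpose:
  assumes "inj f"
  shows "f \<circ> transpose x y = transpose (f x) (f y) \<circ> f"
  using assms by (auto simp: fun_eq_iff transpose_def inj_eq)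

text \<open>Conjugates of the transposition of 1 and 2 by the cycle give the adjacent transpositions
  and so all permutations of \<open>{1..<n}\<close>. Conjugating \<open>id(n - 1 := 0)\<close> and
  \<open>id(n - 1 := 1)\<close> gives every map moving one nonzero point, and from these all maps
  are built by induction on the number of points missed by the image.\<close>

lemma gens_generate:
  assumes n: "n \<ge> 2" and gens: "gens n \<subseteq> K"
    and comp: "\<And>f g. f \<in> K \<Longrightarrow> g \<in> K \<Longrightarrow> f \<circ> g \<in> K"
    and f: "f 0 = 0" "\<And>x. x < n \<Longrightarrow> f x < n" "\<And>x. x \<ge> n \<Longrightarrow> f x = x"
  shows "f \<in> K"
proof -
  let ?X = "{1..<n}"
  have cyc: "cyc n ^^ Suc k \<in> K" for k
  proof (induction k)
    case 0
    show ?case using gens by (auto simp: gens_def)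
  next
    case (Suc k)
    have "cyc n \<in> K" using gens by (auto simp: gens_def)
    from comp[OF this Suc] show ?case by (simp only: funpow.simps(2))
  qed
  have Suc_n: "Suc (n - 2) = n - 1" using n by simp
  \<comment> \<open>The identity arises as the power \<open>n - 1\<close> of the cycle, and the
    inverse of the cycle as the power \<open>n - 2\<close>.\<close>
  have idK: "id \<in> K" using cyc[of "n - 2"] cyc_power_eq_id[OF n] by (simp only: Suc_n)
  have "cyc n ^^ (n - 2) \<circ> cyc n = id"
    using funpow_Suc_right[of "n - 2" "cyc n"] cyc_power_eq_id[OF n] by (simp only: Suc_n)
  hence inj_cyc: "inj (cyc n)" by (intro inj_on_inverseI[of _ "cyc n ^^ (n - 2)"]) (metis comp_apply id_apply)
  have adj: "transpose (Suc k) (Suc (Suc k)) \<in> K" if "Suc (Suc k) < n" for k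
    using that
  proof (induction k)
    case 0
    thus ?case using gens by (auto simp: gens_def numeral_2_eq_2)
  next
    case (Suc k)
    let ?t = "transpose (Suc k) (Suc (Suc k))"
    have "cyc n (Suc k) = Suc (Suc k)" "cyc n (Suc (Suc k)) = Suc (Suc (Suc k))"
      using Suc.prems by (auto simp: cyc_def)
    hence eq: "cyc n \<circ> ?t = transpose (Suc (Suc k)) (Suc (Suc (Suc k))) \<circ> cyc n"
      using inj_comp_transpose[OF inj_cyc] by metis
    have "Suc (n - 3) = n - 2" using Suc.prems by auto
    hence "cyc n ^^ (n - 2) \<in> K" using cyc[of "n - 3"] by (simp only:)
    moreover have "cyc n \<circ> cyc n ^^ (n - 2) = id"
      using funpow.simps(2)[of "n - 2" "cyc n"] cyc_power_eq_id[OF n] by (simp only: Suc_n)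
    moreover have "cyc n \<in> K" using cyc[of 0] by simp
    moreover have "?t \<in> K" using Suc by simp
    ultimately have "cyc n \<circ> ?t \<circ> cyc n ^^ (n - 2) \<in> K" by (intro comp)
    also have "cyc n \<circ> ?t \<circ> cyc n ^^ (n - 2) = transpose (Suc (Suc k)) (Suc (Suc (Suc k)))"
      using eq \<open>cyc n \<circ> cyc n ^^ (n - 2) = id\<close> by (simp add: comp_assoc)
    finally show ?case .
  qed
  \<comment> \<open>The transposition of \<open>i\<close> and \<open>j + 1\<close> is the conjugate
    of that of \<open>i\<close> and \<open>j\<close> by the adjacent one of \<open>j\<close> and
    \<open>j + 1\<close>.\<close>
  have less: "transpose i j \<in> K" if "i < j" "1 \<le> i" "j < n" for i j
    using that
  proof (induction j)
    case (Suc j)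
    show ?case
    proof (cases "i = j")
      case True
      thus ?thesis using adj[of "i - 1"] Suc.prems by simp
    next
      case False
      let ?s = "transpose j (Suc j)"
      have s: "?s \<in> K" using adj[of "j - 1"] Suc.prems by simp
      have "transpose i j \<in> K" using Suc False by simp
      hence "?s \<circ> transpose i j \<circ> ?s \<in> K" using s by (intro comp)
      also have "?s \<circ> transpose i j = transpose i (Suc j) \<circ> ?s"
        using inj_comp_transpose[of ?s i j] False Suc.prems by (simp add: transpose_def)
      finally show ?thesis by (simp add: comp_assoc)
    qed
  qed simp
  have perm: "p \<in> K" if "p permutes ?X" for p
  proof -
    have "finite ?X" by simp
    with that show ?thesis
    proof (induction rule: permutes_induct)
      case id
      show ?case by (rule idK)
    next
      case (swap a b p)
      have "transpose a b \<in> K"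
        using less[of a b] less[of b a] swap.hyps by (cases a b rule: linorder_cases) (auto simp: transpose_commute)
      thus ?case using swap comp by blast
    qed
  qed
  \<comment> \<open>The map is a conjugate of \<open>id(n - 1 := u)\<close> by a permutation
    \<open>p\<close> with \<open>p (n - 1) = z\<close> and \<open>p u = y\<close>. Since
    \<open>p\<close> fixes 0, \<open>u\<close> is 0 for \<open>y = 0\<close>; otherwise
    \<open>u\<close> is 1.\<close>
  have point: "id(z := y) \<in> K" if z: "z \<in> ?X" and y: "y < n" "y \<noteq> z" for z y
  proof -
    obtain p where p: "p permutes ?X" "p (n - 1) = z" and g: "\<exists>u. p u = y \<and> id(n - 1 := u) \<in> K"
    proof (cases "y = 0")
      case True
      have "transpose z (n - 1) permutes ?X" using z n by (intro permutes_swap_id) auto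
      moreover have "transpose z (n - 1) 0 = y" using True z n by (auto simp: transpose_def)
      moreover have "id(n - 1 := 0) \<in> K" using gens by (auto simp: gens_def)
      ultimately show ?thesis using that[of "transpose z (n - 1)"] by auto
    next
      case False
      hence n3: "n \<ge> 3" using z y by auto
      \<comment> \<open>The first swap moves \<open>n - 1\<close> to \<open>z\<close> and 1 to
        \<open>t\<close>; the second moves \<open>t\<close> on to \<open>y\<close> and leaves
        \<open>z\<close> alone.\<close>
      define t where "t = transpose z (n - 1) 1"
      have t: "t \<in> ?X" "t \<noteq> z" using z n3 by (auto simp: t_def transpose_def)
      let ?p = "transpose t y \<circ> transpose z (n - 1)"
      have "?p permutes ?X" using z t y False n3 by (intro permutes_compose permutes_swap_id) auto
      moreover have "?p (n - 1) = z" using t y by (simp add: transpose_def)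
      moreover have "?p 1 = y" by (simp add: t_def)
      moreover have "id(n - 1 := 1) \<in> K" using gens n3 by (auto simp: gens_def)
      ultimately show ?thesis using that[of ?p] by blast
    qed
    from g obtain u where u: "p u = y" "id(n - 1 := u) \<in> K" by blast
    have "p \<circ> id(n - 1 := u) = id(z := y) \<circ> p"
      using p u permutes_inj[OF p(1)] by (auto simp: fun_eq_iff inj_eq)
    hence "p \<circ> id(n - 1 := u) \<circ> inv p = id(z := y)"
      using permutes_inv_o(1)[OF p(1)] by (simp add: comp_assoc)
    moreover have "p \<circ> id(n - 1 := u) \<circ> inv p \<in> K"
      using perm[OF p(1)] perm[OF permutes_inv[OF p(1)]] u(2) by (intro comp)
    ultimately show ?thesis by simp
  qed
  show ?thesis
    using f
  proof (induction "card ({..<n} - f ` {..<n})" arbitrary: f rule: less_induct)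
    case less
    have maps: "f ` {..<n} \<subseteq> {..<n}" using less.prems by auto
    show ?case
    proof (cases "inj_on f {..<n}")
      case True
      hence "f ` {..<n} = {..<n}" using maps by (simp add: endo_inj_surj)
      hence "bij_betw f {..<n} {..<n}" using True by (simp add: bij_betw_def)
      hence "f permutes {..<n}" using less.prems(3) by (intro bij_imp_permutes) auto
      hence "f permutes ({..<n} - {0})"
        by (rule permutes_superset) (use less.prems(1) in auto)
      moreover have "{..<n} - {0} = ?X" by auto
      ultimately show ?thesis using perm by simp
    next
      case False
      then obtain x y where "x < n" "y < n" "x \<noteq> y" "f x = f y" by (auto simp: inj_on_def)
      \<comment> \<open>Of two points with the same image one is nonzero; redirecting that one keeps
        0 fixed.\<close>
      then obtain u v where uv: "u < n" "v < n" "u \<noteq> v" "f u = f v" "u \<noteq> 0" by metis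
      have "f ` {..<n} \<noteq> {..<n}" using False by (metis eq_card_imp_inj_on finite_lessThan)
      then obtain z where z: "z < n" "z \<notin> f ` {..<n}" using maps by blast
      have "0 \<in> f ` {..<n}" using n less.prems(1) by (intro image_eqI[of _ _ 0]) auto
      hence z0: "z \<noteq> 0" using z by metis
      \<comment> \<open>Redirecting \<open>u\<close> to a missed point \<open>z\<close> enlarges the image, and \<open>f\<close> is recovered by moving \<open>z\<close> to \<open>f u\<close>.\<close>
      let ?f = "f(u := z)"
      have "?f ` {..<n} = insert z (f ` {..<n})"
      proof
        show "insert z (f ` {..<n}) \<subseteq> ?f ` {..<n}"
        proof
          fix y assume "y \<in> insert z (f ` {..<n})"
          then consider "y = z" | x where "x < n" "y = f x" by auto
          thus "y \<in> ?f ` {..<n}"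
          proof cases
            case 1
            thus ?thesis using uv by (intro image_eqI[of _ _ u]) auto
          next
            case 2
            thus ?thesis using uv by (intro image_eqI[of _ _ "if x = u then v else x"]) auto
          qed
        qed
      qed auto
      hence "{..<n} - ?f ` {..<n} \<subset> {..<n} - f ` {..<n}" using z by auto
      hence "card ({..<n} - ?f ` {..<n}) < card ({..<n} - f ` {..<n})"
        by (intro psubset_card_mono) auto
      hence "?f \<in> K" using less.prems uv z by (intro less.hyps) auto
      moreover have "id(z := f u) \<in> K"
        using z z0 uv less.prems(2) by (intro point) auto
      ultimately have "id(z := f u) \<circ> ?f \<in> K" by (intro comp)
      moreover have "id(z := f u) \<circ> ?f = f"
      proof
        fix x show "(id(z := f u) \<circ> ?f) x = f x"
          using z less.prems(3)[of x] by (cases "x < n") auto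
      qed
      ultimately show ?thesis by simp
    qed
  qed
qed

section \<open>From generators to languages attaining the bound\<close>

text \<open>Since \<open>fold\<close> reads letters from the left, the composition belongs to the
  word of \<open>g\<close> followed by the word of \<open>f\<close>.\<close>

lemma fold_comp_closed:
  assumes "f \<in> fold \<delta> ` (lists \<Sigma> - {[]})" and "g \<in> fold \<delta> ` (lists \<Sigma> - {[]})"
  shows "f \<circ> g \<in> fold \<delta> ` (lists \<Sigma> - {[]})"
proof -
  from assms obtain u v where "u \<in> lists \<Sigma> - {[]}" "f = fold \<delta> u" "v \<in> lists \<Sigma> - {[]}" "g = fold \<delta> v"
    by blast
  thus ?thesis by (intro image_eqI[of _ _ "v @ u"]) auto
qed

text \<open>Products of maps that fix 0 or are constant are again of this kind. Conversely
  \<open>gens_generate\<close> supplies the maps fixing 0, extended by the identity from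
  \<open>n\<close> on, and the constant \<open>c\<close> is the constant 1 followed by
  \<open>id(1 := c)\<close>.\<close>

lemma word_maps_gens:
  assumes n: "n \<ge> 2" and \<delta>: "\<delta> ` \<Sigma> = gens n"
  shows "word_maps \<Sigma> \<delta> {..<n} = fixing_or_const {..<n} 0"
proof (intro equalityI subsetI)
  have step: "fold \<delta> w x < n" if "w \<in> lists \<Sigma>" "x < n" for w x
    using fold_closed[of \<Sigma> "{..<n}" \<delta> w x] gens_closed[OF n] \<delta> that by auto
  have alt: "fold \<delta> w 0 = 0 \<or> (\<forall>x<n. \<forall>y<n. fold \<delta> w x = fold \<delta> w y)" if "w \<in> lists \<Sigma>" for w
    using that
  proof (induction w rule: list.induct)
    case (Cons a w)
    have "\<delta> a 0 = 0 \<or> \<delta> a = (\<lambda>_. 1)" using gens_fixing_or_const[OF n] \<delta> Cons.prems by auto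
    moreover have a: "\<delta> a x < n" if "x < n" for x using gens_closed[OF n] \<delta> Cons.prems that by auto
    moreover have "fold \<delta> w 0 = 0 \<or> (\<forall>x<n. \<forall>y<n. fold \<delta> w x = fold \<delta> w y)" using Cons by simp
    ultimately consider "\<delta> a = (\<lambda>_. 1)" | "\<delta> a 0 = 0" "fold \<delta> w 0 = 0"
      | "\<forall>x<n. \<forall>y<n. fold \<delta> w x = fold \<delta> w y" by metis
    thus ?case
    proof cases
      case 3
      have "fold \<delta> (a # w) x = fold \<delta> (a # w) y" if "x < n" "y < n" for x y
        unfolding fold_simps using 3 a[OF that(1)] a[OF that(2)] by blast
      thus ?thesis by blast
    qed simp_all
  qed simp
  fix f assume "f \<in> word_maps \<Sigma> \<delta> {..<n}"
  then obtain w where w: "w \<in> lists \<Sigma>" "f = restrict (fold \<delta> w) {..<n}" by (auto simp: word_maps_def)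
  have f: "f \<in> {..<n} \<rightarrow>\<^sub>E {..<n}" using step[OF w(1)] by (auto simp: w(2))
  show "f \<in> fixing_or_const {..<n} 0"
  proof (cases "f 0 = 0")
    case True
    thus ?thesis using f by (simp add: fixing_or_const_def)
  next
    case False
    have "0 < n" using n by simp
    moreover have "fold \<delta> w 0 \<noteq> 0" using False \<open>0 < n\<close> by (simp add: w(2))
    ultimately have "fold \<delta> w x = fold \<delta> w 0" if "x < n" for x using alt[OF w(1)] that by metis
    moreover have "f x = fold \<delta> w x" if "x < n" for x using that by (simp add: w(2))
    ultimately have "f x = f 0" if "x < n" for x using that \<open>0 < n\<close> by metis
    hence "f = (\<lambda>x\<in>{..<n}. f 0)"
      using f by (intro ext) (metis PiE_arb lessThan_iff restrict_apply)
    moreover have "f 0 \<in> {..<n} - {0}" using False PiE_mem[OF f, of 0] \<open>0 < n\<close> by simp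
    ultimately show ?thesis
      unfolding fixing_or_const_def by (intro UnI2 image_eqI[of f _ "f 0"])
  qed
next
  let ?K = "fold \<delta> ` (lists \<Sigma> - {[]})"
  have gK: "gens n \<subseteq> ?K"
  proof
    fix g assume "g \<in> gens n"
    then obtain a where "a \<in> \<Sigma>" "g = \<delta> a" using \<delta> by blast
    thus "g \<in> ?K" by (intro image_eqI[of _ _ "[a]"]) auto
  qed
  have K: "f \<in> ?K" if "f 0 = 0" "\<And>x. x < n \<Longrightarrow> f x < n" "\<And>x. x \<ge> n \<Longrightarrow> f x = x" for f
    using gens_generate[OF n gK fold_comp_closed that] .
  fix f assume "f \<in> fixing_or_const {..<n} 0"
  then consider "f \<in> {..<n} \<rightarrow>\<^sub>E {..<n}" "f 0 = 0" | c where "0 < c" "c < n" "f = (\<lambda>x\<in>{..<n}. c)"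
    by (auto simp: fixing_or_const_def)
  hence "\<exists>h\<in>?K. f = restrict h {..<n}"
  proof cases
    case 1
    let ?h = "\<lambda>x. if x < n then f x else x"
    have "?h \<in> ?K" using 1 n by (intro K) auto
    moreover have "f = restrict ?h {..<n}" using 1 by (auto simp: PiE_iff extensional_def)
    ultimately show ?thesis by blast
  next
    case 2
    have "(\<lambda>_. 1) \<in> ?K" using gK by (auto simp: gens_def)
    moreover have "id(1 := c) \<in> ?K" using 2 n by (intro K) auto
    ultimately have "id(1 := c) \<circ> (\<lambda>_. 1) \<in> ?K" by (intro fold_comp_closed)
    moreover have "f = restrict (id(1 := c) \<circ> (\<lambda>_. 1)) {..<n}" by (auto simp: 2)
    ultimately show ?thesis by blast
  qed
  thus "f \<in> word_maps \<Sigma> \<delta> {..<n}" unfolding word_maps_def by blast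
qed

text \<open>Take \<open>m\<close> as initial state and a single accepting state \<open>r\<close>
  other than \<open>m\<close>. A word leading from \<open>m\<close> to \<open>r\<close> does not fix
  \<open>m\<close>, so it is constant, and any word may be put in front without changing the
  outcome.\<close>

lemma left_ideal_from_word_maps:
  fixes \<delta> :: "'a \<Rightarrow> 's \<Rightarrow> 's"
  assumes fin: "finite S" and m: "m \<in> S" and n2: "card S \<ge> 2"
    and closed: "\<And>a q. a \<in> \<Sigma> \<Longrightarrow> q \<in> S \<Longrightarrow> \<delta> a q \<in> S"
    and gen: "word_maps \<Sigma> \<delta> S = fixing_or_const S m"
  shows "\<exists>L. L \<subseteq> lists \<Sigma> \<and> left_ideal \<Sigma> L \<and> kappa \<Sigma> L = card S
    \<and> sigma \<Sigma> L = card S ^ (card S - 1) + card S - 1"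
proof -
  have "S \<noteq> {m}" using n2 by auto
  then obtain r where r: "r \<in> S" "r \<noteq> m" using m by blast
  define L where "L = {w \<in> lists \<Sigma>. fold \<delta> w m \<in> {r}}"
  have word: "\<exists>w\<in>lists \<Sigma>. \<forall>x\<in>S. fold \<delta> w x = f x" if "restrict f S \<in> fixing_or_const S m" for f
  proof -
    from that gen obtain w where w: "w \<in> lists \<Sigma>" "restrict f S = restrict (fold \<delta> w) S"
      unfolding word_maps_def by blast
    hence "\<forall>x\<in>S. fold \<delta> w x = f x" by (metis restrict_apply')
    thus ?thesis using w by blast
  qed
  have const: "\<exists>w\<in>lists \<Sigma>. \<forall>x\<in>S. fold \<delta> w x = c" if "c \<in> S - {m}" for c
    using word[of "\<lambda>_. c"] that by (auto simp: fixing_or_const_def)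
  have S: "S = (\<lambda>w. fold \<delta> w m) ` lists \<Sigma>"
  proof (intro equalityI subsetI)
    fix q assume q: "q \<in> S"
    show "q \<in> (\<lambda>w. fold \<delta> w m) ` lists \<Sigma>"
    proof (cases "q = m")
      case True
      thus ?thesis by (intro image_eqI[of _ _ "[]"]) auto
    next
      case False
      with const q obtain w where "w \<in> lists \<Sigma>" "fold \<delta> w m = q" using m by blast
      thus ?thesis by blast
    qed
  next
    fix q assume "q \<in> (\<lambda>w. fold \<delta> w m) ` lists \<Sigma>"
    then obtain w where "w \<in> lists \<Sigma>" "q = fold \<delta> w m" by blast
    thus "q \<in> S" using fold_closed[of \<Sigma> S \<delta> w m, OF closed] m by simp
  qed
  \<comment> \<open>The test map sends \<open>p\<close> to \<open>r\<close> and all else to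
    \<open>m\<close>. It has to fix \<open>m\<close>, hence \<open>p \<noteq> m\<close>; of two
    distinct states at least one can serve as \<open>p\<close>.\<close>
  have separated: "\<exists>v\<in>lists \<Sigma>. fold \<delta> v p \<in> {r} \<and> fold \<delta> v q \<notin> {r}"
    if pq: "p \<in> S" "q \<in> S" "p \<noteq> q" "p \<noteq> m" for p q
  proof -
    have "restrict (\<lambda>x. if x = p then r else m) S \<in> fixing_or_const S m"
      using pq r m by (auto simp: fixing_or_const_def)
    from word[OF this] obtain v where "v \<in> lists \<Sigma>" "\<forall>x\<in>S. fold \<delta> v x = (if x = p then r else m)"
      by blast
    thus ?thesis using pq r by (intro bexI[of _ v]) auto
  qed
  have sep: "p = q" if pq: "p \<in> S" "q \<in> S"
    and eq: "\<And>v. v \<in> lists \<Sigma> \<Longrightarrow> fold \<delta> v p \<in> {r} \<longleftrightarrow> fold \<delta> v q \<in> {r}" for p q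
    using separated[of p q] separated[of q p] pq eq by metis
  have "left_ideal \<Sigma> L"
  proof (rule left_idealI)
    obtain w where "w \<in> lists \<Sigma>" "fold \<delta> w m = r" using const[of r] r m by blast
    thus "L \<noteq> {}" by (auto simp: L_def)
    fix u v assume u: "u \<in> lists \<Sigma>" and v: "v \<in> L"
    \<comment> \<open>The empty word leads to \<open>m\<close> and is not accepted;
      \<open>word_maps\<close> covers only nonempty words.\<close>
    have "v \<noteq> []" using v r by (auto simp: L_def)
    hence "restrict (fold \<delta> v) S \<in> fixing_or_const S m"
      using v unfolding gen[symmetric] word_maps_def L_def by blast
    moreover have "restrict (fold \<delta> v) S m \<noteq> m" using v r m by (auto simp: L_def)
    ultimately obtain c where "restrict (fold \<delta> v) S = (\<lambda>x\<in>S. c)"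
      unfolding fixing_or_const_def by blast
    hence "\<forall>x\<in>S. fold \<delta> v x = c" by (metis restrict_apply')
    moreover have "fold \<delta> u m \<in> S" by (rule fold_closed[of \<Sigma> S \<delta> u m, OF closed u m])
    ultimately have "fold \<delta> v (fold \<delta> u m) = fold \<delta> v m" using m by simp
    thus "u @ v \<in> L" using u v by (simp add: L_def)
  qed
  moreover have "L \<subseteq> lists \<Sigma>" unfolding L_def by blast
  moreover have "kappa \<Sigma> L = card S" by (rule dfa_kappa_sigma(1)[OF S L_def sep])
  moreover have "sigma \<Sigma> L = card (word_maps \<Sigma> \<delta> S)" by (rule dfa_kappa_sigma(2)[OF S L_def sep])
  ultimately show ?thesis using gen card_fixing_or_const[OF fin m] by auto
qed

text \<open>This spreads the generators over any alphabet that is large enough, possibly with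
  several letters inducing the same map.\<close>

lemma surj_onto_if_card_le:
  assumes "finite A" and "finite B" and "card B \<le> card A" and "B \<noteq> {}"
  shows "\<exists>g. g ` A = B"
proof -
  obtain h where h: "h ` B \<subseteq> A" "inj_on h B" using card_le_inj[OF assms(2,1,3)] by blast
  obtain b where b: "b \<in> B" using assms(4) by blast
  let ?g = "\<lambda>a. if a \<in> h ` B then inv_into B h a else b"
  have "?g ` A \<subseteq> B" using b by (auto intro: inv_into_into)
  moreover have "y \<in> ?g ` A" if "y \<in> B" for y
    using that h by (intro image_eqI[of _ _ "h y"]) auto
  ultimately show ?thesis by blast
qed

lemma left_ideal_witness:
  assumes "finite \<Sigma>" and "\<Sigma> \<noteq> {}" and "n \<ge> 1" and "card \<Sigma> \<ge> min_alph n"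
  shows "\<exists>L. L \<subseteq> lists \<Sigma> \<and> left_ideal \<Sigma> L \<and> kappa \<Sigma> L = n \<and> sigma \<Sigma> L = n ^ (n - 1) + n - 1"
proof (cases "n = 1")
  case True
  thus ?thesis using kappa_lists[of \<Sigma>] left_ideal_lists[of \<Sigma>] sigma_lists[OF assms(2)]
    by (intro exI[of _ "lists \<Sigma>"]) simp
next
  case False
  hence n: "n \<ge> 2" using assms(3) by simp
  have "card (gens n) \<le> card \<Sigma>" using card_gens(2)[OF n] assms(4) by linarith
  moreover have "gens n \<noteq> {}" by (simp add: gens_def)
  ultimately obtain \<delta> where \<delta>: "\<delta> ` \<Sigma> = gens n"
    using surj_onto_if_card_le[OF assms(1) card_gens(1)[OF n]] by blast
  have "\<delta> a q \<in> {..<n}" if "a \<in> \<Sigma>" "q \<in> {..<n}" for a q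
    using gens_closed[OF n] \<delta> that by auto
  thus ?thesis
    using left_ideal_from_word_maps[of "{..<n}" 0 \<Sigma> \<delta>] word_maps_gens[OF n \<delta>] n by simp
qed

text \<open>Attaining the bound makes the words realise all of \<open>fixing_or_const\<close> on the
  quotients, so the letter count applies. A single quotient only requires a nonempty
  alphabet.\<close>

lemma left_ideal_card_alphabet_ge:
  assumes "finite \<Sigma>" and "\<Sigma> \<noteq> {}" and "L \<subseteq> lists \<Sigma>" and "left_ideal \<Sigma> L"
    and "kappa \<Sigma> L = n" and "n \<ge> 1" and "sigma \<Sigma> L = n ^ (n - 1) + n - 1"
  shows "min_alph n \<le> card \<Sigma>"
proof (cases "n = 1")
  case True
  thus ?thesis using assms(1,2) by (simp add: min_alph_def Suc_le_eq card_gt_0_iff)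
next
  case False
  have card: "card (quotients \<Sigma> L) = n" using quotient_dfa(1)[OF assms(3)] assms(5) by simp
  moreover have "finite (quotients \<Sigma> L)" using card assms(6) by (metis card.infinite not_one_le_zero)
  moreover have "L \<in> quotients \<Sigma> L" unfolding quotients_def
    by (rule image_eqI[of _ _ "[]"]) (auto simp: quotient_lang_def)
  ultimately have "min_alph (card (quotients \<Sigma> L)) \<le> card \<Sigma>"
    using False assms(6) left_ideal_sigma(2)[OF assms(3-7)]
    by (intro card_alphabet_ge[OF assms(1), where m = L and \<delta> = letter_quotient])
       (auto intro: letter_quotient_closed)
  thus ?thesis by (simp only: card)
qed

section \<open>The bound, its tightness and the minimal alphabet sizes\<close>

theorem theorem4:
  fixes \<Sigma> :: "'a set"
  assumes "finite \<Sigma>" and "\<Sigma> \<noteq> {}"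
  shows
    "(\<forall>L n. L \<subseteq> lists \<Sigma> \<and> kappa \<Sigma> L = n \<and> n \<ge> 1 \<and>
            (left_ideal \<Sigma> L \<or> suffix_closed L)
          \<longrightarrow> sigma \<Sigma> L \<le> n ^ (n - 1) + n - 1)
   \<and> (\<forall>n \<ge> 1. card \<Sigma> \<ge> min_alph n \<longrightarrow>
          (\<exists>L. L \<subseteq> lists \<Sigma> \<and> left_ideal \<Sigma> L \<and> kappa \<Sigma> L = n
                \<and> sigma \<Sigma> L = n ^ (n - 1) + n - 1)
        \<and> (\<exists>L. L \<subseteq> lists \<Sigma> \<and> suffix_closed L \<and> kappa \<Sigma> L = n
                \<and> sigma \<Sigma> L = n ^ (n - 1) + n - 1))
   \<and> (\<forall>n \<ge> 1. card \<Sigma> < min_alph n \<longrightarrow>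
          (\<forall>L. L \<subseteq> lists \<Sigma> \<and> kappa \<Sigma> L = n \<and> (left_ideal \<Sigma> L \<or> suffix_closed L)
                \<longrightarrow> sigma \<Sigma> L \<noteq> n ^ (n - 1) + n - 1))"
proof -
  \<comment> \<open>A suffix-closed language that is not a left ideal is not the full language, so
    its complement is a left ideal with the same \<open>kappa\<close> and
    \<open>sigma\<close>.\<close>
  have reduce: "\<exists>L'. L' \<subseteq> lists \<Sigma> \<and> left_ideal \<Sigma> L' \<and> kappa \<Sigma> L' = kappa \<Sigma> L \<and> sigma \<Sigma> L' = sigma \<Sigma> L"
    if L: "L \<subseteq> lists \<Sigma>" "left_ideal \<Sigma> L \<or> suffix_closed L" for L
  proof (cases "left_ideal \<Sigma> L")
    case False
    hence "suffix_closed L" "L \<noteq> lists \<Sigma>" using L(2) left_ideal_lists by auto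
    thus ?thesis
      using left_ideal_complement[OF L(1)] kappa_complement[OF L(1)] sigma_complement[of \<Sigma> L]
      by (intro exI[of _ "lists \<Sigma> - L"]) blast
  qed (use L(1) in blast)
  have bound: "sigma \<Sigma> L \<le> n ^ (n - 1) + n - 1"
    if "L \<subseteq> lists \<Sigma>" "kappa \<Sigma> L = n" "n \<ge> 1" "left_ideal \<Sigma> L \<or> suffix_closed L" for L n
    using reduce[OF that(1,4)] left_ideal_sigma(1) that(2,3) by metis
  have alph: "min_alph n \<le> card \<Sigma>"
    if "L \<subseteq> lists \<Sigma>" "kappa \<Sigma> L = n" "n \<ge> 1" "left_ideal \<Sigma> L \<or> suffix_closed L"
      "sigma \<Sigma> L = n ^ (n - 1) + n - 1" for L n
    using reduce[OF that(1,4)] left_ideal_card_alphabet_ge[OF assms] that(2,3,5) by metis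
  have witness: "(\<exists>L. L \<subseteq> lists \<Sigma> \<and> left_ideal \<Sigma> L \<and> kappa \<Sigma> L = n
                \<and> sigma \<Sigma> L = n ^ (n - 1) + n - 1)
        \<and> (\<exists>L. L \<subseteq> lists \<Sigma> \<and> suffix_closed L \<and> kappa \<Sigma> L = n
                \<and> sigma \<Sigma> L = n ^ (n - 1) + n - 1)"
    if n: "n \<ge> 1" "card \<Sigma> \<ge> min_alph n" for n
  proof -
    obtain L where L: "L \<subseteq> lists \<Sigma>" "left_ideal \<Sigma> L" "kappa \<Sigma> L = n"
        "sigma \<Sigma> L = n ^ (n - 1) + n - 1"
      using left_ideal_witness[OF assms n] by blast
    moreover have "lists \<Sigma> - L \<subseteq> lists \<Sigma>" by blast
    ultimately show ?thesis
      using suffix_closed_complement[OF L(2)] kappa_complement[OF L(1)] sigma_complement[of \<Sigma> L]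
      by metis
  qed
  show ?thesis
    by (intro conjI allI impI) (use bound witness alph in \<open>auto simp flip: not_le\<close>)
qed

end
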